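(* Let $(\mathbb V,\otimes,I)$ be a monoidal category. A relative monad in the virtual equipment of $\mathbb V$-categories is equivalently specified by (1) a $\mathbb V$-functor $j\colon A\to E$; (2) a function $|t|\colon|A|\to|E|$ on objects; (3) a morphism $\dagger_{x,y}\colon E(|j|x,|t|y)\to E(|t|x,|t|y)$ in $\mathbb V$ for each $x,y\in|A|$; (4) a morphism $\eta_x\colon I\to E(|j|x,|t|x)$ in $\mathbb V$ for each $x\in|A|$, satisfying, for all $x,y,z\in|A|$: (i) $E(\eta_x,|t|y)\circ\dagger_{x,y}=1_{E(|j|x,|t|y)}$; (ii) $\dagger_{x,x}\circ\eta_x$ is the identity $I\to E(|t|x,|t|x)$ of $|t|x$; (iii) the two morphisms $E(|j|x,|t|y)\otimes E(|j|y,|t|z)\to E(|t|x,|t|z)$ given by $\dagger_{x,y}\otimes\dagger_{y,z}$ followed by composition in $E$, and by $1\otimes\dagger_{y,z}$ followed by composition $E(|j|x,|t|y)\otimes E(|t|y,|t|z)\to E(|j|x,|t|z)$ followed by $\dagger_{x,z}$, are equal. (That is, $|t|$ extends uniquely to a $\mathbb V$-functor $t\colon A\to E$ such that $(t,\dagger,\eta)$ is a $j$-relative monad, and every relative monad arises in this way.) For a $\mathbb V$-functor $j\colon A\to E$ and $j$-relative monads $(t,\dagger,\eta)$, $(t',\dagger',\eta')$, a $j$-relative monad morphism is equivalently specified by a morphism $\tau_x\colon I\to E(|t|x,|t'|x)$ in $\mathbb V$ for each $x\in|A|$ such that, for all $x,y\in|A|$, $E(|j|x,\tau_x)\circ\eta_x=\eta'_x$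 and $E(|t|x,\tau_y)\circ\dagger_{x,y}=E(\tau_x,|t'|y)\circ\dagger'_{x,y}\circ E(|j|x,\tau_y)$ as morphisms $E(|j|x,|t|y)\to E(|t|x,|t'|y)$.
   Context: $\mathbb V$ is not assumed symmetric, closed or (co)complete. A $\mathbb V$-category $C$ has a class $|C|$ of objects, hom-objects $C(x,y)$, identities $I\to C(x,x)$, and composition $C(x,y)\otimes C(y,z)\to C(x,z)$ (in this order). A $\mathbb V$-functor $f\colon C\to D$ has an object function $|f|$ and morphisms $f_{x,y}\colon C(x,y)\to D(|f|x,|f|y)$. For $h\colon I\to E(b,c)$, $E(a,h)\colon E(a,b)\to E(a,c)$ and $E(h,d)\colon E(c,d)\to E(b,d)$ denote post- and precomposition with $h$. Relative monads of $\mathbb V$-categories (i.e. relative monads in the virtual equipment whose objects, tight-cells, loose-cells and 2-cells are $\mathbb V$-categories, $\mathbb V$-functors, $\mathbb V$-distributors and $\mathbb V$-natural transformations). A relative monad comprises $\mathbb V$-functors $j\colon A\to E$ (root) and $t\colon A\to E$, together with families $\dagger_{x,y}\colon E(|j|x,|t|y)\to E(|t|x,|t|y)$ and $\eta_x\colon I\to E(|j|x,|t|x)$ satisfying (i)–(iii) of the claim, which are moreover $\mathbb V$-natural: for $\eta$, $E(|j|x,\eta_y)\circ j_{x,y}=E(\eta_x,|t|y)\circ t_{x,y}\colon A(x,y)\to E(|j|x,|t|y)$; for $\dagger$, (a) the morphisms $A(x,y)\otimes E(|j|y,|t|z)\to E(|t|x,|t|z)$ given by $j_{x,y}\otimes1$,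 composition, then $\dagger_{x,z}$, and by $t_{x,y}\otimes\dagger_{y,z}$ then composition, are equal; (b) the morphisms $E(|j|x,|t|y)\otimes A(y,z)\to E(|t|x,|t|z)$ given by $1\otimes t_{y,z}$, composition, then $\dagger_{x,z}$, and by $\dagger_{x,y}\otimes t_{y,z}$ then composition, are equal. A morphism of $j$-relative monads is a $\mathbb V$-natural transformation $\tau\colon t\Rightarrow t'$ (i.e. $E(|t|x,\tau_y)\circ t_{x,y}=E(\tau_x,|t'|y)\circ t'_{x,y}$) satisfying the two equations in the claim. *)

theory Defs
  imports Main "HOL-Library.FuncSet"
begin

section \<open>Monoidal categories\<close>

record ('o, 'm) moncat =
  Obj :: "'o set"
  Arr :: "'m set"
  Dom :: "'m \<Rightarrow> 'o"
  Cod :: "'m \<Rightarrow> 'o"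
  Ident :: "'o \<Rightarrow> 'm"
  Comp :: "'m \<Rightarrow> 'm \<Rightarrow> 'm"  (infixr "\<cdot>\<index>" 65)
  tensor_obj :: "'o \<Rightarrow> 'o \<Rightarrow> 'o"  (infixl "\<otimes>\<index>" 70)
  tensor_arr :: "'m \<Rightarrow> 'm \<Rightarrow> 'm"  (infixl "\<boxtimes>\<index>" 70)
  unit_obj :: 'o  ("\<I>\<index>")
  assoc :: "'o \<Rightarrow> 'o \<Rightarrow> 'o \<Rightarrow> 'm"
  lunit :: "'o \<Rightarrow> 'm"
  runit :: "'o \<Rightarrow> 'm"

text \<open>Composition is written in the applicative order: \<open>g \<cdot> f\<close> is \<open>f\<close> followed by \<open>g\<close>.\<close>

definition hom :: "('o, 'm) moncat \<Rightarrow> 'o \<Rightarrow> 'o \<Rightarrow> 'm set" where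
  "hom V x y = {f \<in> Arr V. Dom V f = x \<and> Cod V f = y}"

definition inverse_arrows :: "('o, 'm) moncat \<Rightarrow> 'm \<Rightarrow> 'm \<Rightarrow> bool" where
  "inverse_arrows V f g \<longleftrightarrow>
     f \<in> Arr V \<and> g \<in> hom V (Cod V f) (Dom V f) \<and>
     g \<cdot>\<^bsub>V\<^esub> f = Ident V (Dom V f) \<and> f \<cdot>\<^bsub>V\<^esub> g = Ident V (Cod V f)"

definition iso_arr :: "('o, 'm) moncat \<Rightarrow> 'm \<Rightarrow> bool" where
  "iso_arr V f \<longleftrightarrow> (\<exists>g. inverse_arrows V f g)"

definition inv_arr :: "('o, 'm) moncat \<Rightarrow> 'm \<Rightarrow> 'm" where
  "inv_arr V f = (THE g. inverse_arrows V f g)"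

locale category =
  fixes V :: "('o, 'm) moncat" (structure)
  assumes dom_obj: "f \<in> Arr V \<Longrightarrow> Dom V f \<in> Obj V"
    and cod_obj: "f \<in> Arr V \<Longrightarrow> Cod V f \<in> Obj V"
    and id_hom: "x \<in> Obj V \<Longrightarrow> Ident V x \<in> hom V x x"
    and comp_hom: "\<lbrakk>f \<in> hom V x y; g \<in> hom V y z\<rbrakk> \<Longrightarrow> g \<cdot> f \<in> hom V x z"
    and id_comp: "f \<in> hom V x y \<Longrightarrow> Ident V y \<cdot> f = f"
    and comp_id: "f \<in> hom V x y \<Longrightarrow> f \<cdot> Ident V x = f"
    and comp_assoc: "\<lbrakk>f \<in> hom V w x; g \<in> hom V x y; h \<in> hom V y z\<rbrakk>
      \<Longrightarrow> (h \<cdot> g) \<cdot> f = h \<cdot> (g \<cdot> f)"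

locale monoidal_category = category V for V :: "('o, 'm) moncat" (structure) +
  assumes unit_obj: "\<I> \<in> Obj V"
    and tensor_obj: "\<lbrakk>x \<in> Obj V; y \<in> Obj V\<rbrakk> \<Longrightarrow> x \<otimes> y \<in> Obj V"
    and tensor_hom: "\<lbrakk>f \<in> hom V x y; g \<in> hom V x' y'\<rbrakk>
      \<Longrightarrow> f \<boxtimes> g \<in> hom V (x \<otimes> x') (y \<otimes> y')"
    and tensor_id: "\<lbrakk>x \<in> Obj V; y \<in> Obj V\<rbrakk> \<Longrightarrow> Ident V x \<boxtimes> Ident V y = Ident V (x \<otimes> y)"
    and tensor_comp:
      "\<lbrakk>f \<in> hom V x y; g \<in> hom V y z; f' \<in> hom V x' y'; g' \<in> hom V y' z'\<rbrakk>
        \<Longrightarrow> (g \<cdot> f) \<boxtimes> (g' \<cdot> f') = (g \<boxtimes> g') \<cdot> (f \<boxtimes> f')"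
    and assoc_hom: "\<lbrakk>x \<in> Obj V; y \<in> Obj V; z \<in> Obj V\<rbrakk>
      \<Longrightarrow> assoc V x y z \<in> hom V ((x \<otimes> y) \<otimes> z) (x \<otimes> (y \<otimes> z))"
    and assoc_iso: "\<lbrakk>x \<in> Obj V; y \<in> Obj V; z \<in> Obj V\<rbrakk> \<Longrightarrow> iso_arr V (assoc V x y z)"
    and lunit_hom: "x \<in> Obj V \<Longrightarrow> lunit V x \<in> hom V (\<I> \<otimes> x) x"
    and lunit_iso: "x \<in> Obj V \<Longrightarrow> iso_arr V (lunit V x)"
    and runit_hom: "x \<in> Obj V \<Longrightarrow> runit V x \<in> hom V (x \<otimes> \<I>) x"
    and runit_iso: "x \<in> Obj V \<Longrightarrow> iso_arr V (runit V x)"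
    and assoc_natural:
      "\<lbrakk>f \<in> hom V x x'; g \<in> hom V y y'; h \<in> hom V z z'\<rbrakk>
        \<Longrightarrow> assoc V x' y' z' \<cdot> ((f \<boxtimes> g) \<boxtimes> h) = (f \<boxtimes> (g \<boxtimes> h)) \<cdot> assoc V x y z"
    and lunit_natural: "f \<in> hom V x y \<Longrightarrow> lunit V y \<cdot> (Ident V \<I> \<boxtimes> f) = f \<cdot> lunit V x"
    and runit_natural: "f \<in> hom V x y \<Longrightarrow> runit V y \<cdot> (f \<boxtimes> Ident V \<I>) = f \<cdot> runit V x"
    and pentagon: "\<lbrakk>w \<in> Obj V; x \<in> Obj V; y \<in> Obj V; z \<in> Obj V\<rbrakk>
      \<Longrightarrow> (Ident V w \<boxtimes> assoc V x y z) \<cdot> assoc V w (x \<otimes> y) z \<cdot> (assoc V w x y \<boxtimes> Ident V z)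
          = assoc V w x (y \<otimes> z) \<cdot> assoc V (w \<otimes> x) y z"
    and triangle: "\<lbrakk>x \<in> Obj V; y \<in> Obj V\<rbrakk>
      \<Longrightarrow> (Ident V x \<boxtimes> lunit V y) \<cdot> assoc V x \<I> y = runit V x \<boxtimes> Ident V y"

section \<open>Enriched categories, functors and natural transformations\<close>

record ('a, 'o, 'm) vcat =
  vobj :: "'a set"
  vhom :: "'a \<Rightarrow> 'a \<Rightarrow> 'o"
  vid :: "'a \<Rightarrow> 'm"
  vcomp :: "'a \<Rightarrow> 'a \<Rightarrow> 'a \<Rightarrow> 'm"

locale vcategory = monoidal_category V for V :: "('o, 'm) moncat" (structure) +
  fixes C :: "('a, 'o, 'm) vcat"
  assumes vhom_obj: "\<lbrakk>x \<in> vobj C; y \<in> vobj C\<rbrakk> \<Longrightarrow> vhom C x y \<in> Obj V"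
    and vid_hom: "x \<in> vobj C \<Longrightarrow> vid C x \<in> hom V \<I> (vhom C x x)"
    and vcomp_hom: "\<lbrakk>x \<in> vobj C; y \<in> vobj C; z \<in> vobj C\<rbrakk>
      \<Longrightarrow> vcomp C x y z \<in> hom V (vhom C x y \<otimes> vhom C y z) (vhom C x z)"
    and vid_left: "\<lbrakk>x \<in> vobj C; y \<in> vobj C\<rbrakk>
      \<Longrightarrow> vcomp C x x y \<cdot> (vid C x \<boxtimes> Ident V (vhom C x y)) = lunit V (vhom C x y)"
    and vid_right: "\<lbrakk>x \<in> vobj C; y \<in> vobj C\<rbrakk>
      \<Longrightarrow> vcomp C x y y \<cdot> (Ident V (vhom C x y) \<boxtimes> vid C y) = runit V (vhom C x y)"
    and vcomp_assoc: "\<lbrakk>w \<in> vobj C; x \<in> vobj C; y \<in> vobj C; z \<in> vobj C\<rbrakk>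
      \<Longrightarrow> vcomp C w y z \<cdot> (vcomp C w x y \<boxtimes> Ident V (vhom C y z))
          = vcomp C w x z \<cdot> (Ident V (vhom C w x) \<boxtimes> vcomp C x y z)
              \<cdot> assoc V (vhom C w x) (vhom C x y) (vhom C y z)"

text \<open>
  \<open>vpost V E a b c h\<close> is \<open>E(a,h) : E(a,b) \<rightarrow> E(a,c)\<close> and \<open>vpre V E b c d h\<close> is
  \<open>E(h,d) : E(c,d) \<rightarrow> E(b,d)\<close>, for \<open>h : I \<rightarrow> E(b,c)\<close>.
\<close>

definition vpost ::
  "('o, 'm) moncat \<Rightarrow> ('e, 'o, 'm) vcat \<Rightarrow> 'e \<Rightarrow> 'e \<Rightarrow> 'e \<Rightarrow> 'm \<Rightarrow> 'm" where
  "vpost V E a b c h =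
     vcomp E a b c \<cdot>\<^bsub>V\<^esub> (Ident V (vhom E a b) \<boxtimes>\<^bsub>V\<^esub> h) \<cdot>\<^bsub>V\<^esub> inv_arr V (runit V (vhom E a b))"

definition vpre ::
  "('o, 'm) moncat \<Rightarrow> ('e, 'o, 'm) vcat \<Rightarrow> 'e \<Rightarrow> 'e \<Rightarrow> 'e \<Rightarrow> 'm \<Rightarrow> 'm" where
  "vpre V E b c d h =
     vcomp E b c d \<cdot>\<^bsub>V\<^esub> (h \<boxtimes>\<^bsub>V\<^esub> Ident V (vhom E c d)) \<cdot>\<^bsub>V\<^esub> inv_arr V (lunit V (vhom E c d))"

text \<open>
  Functions and families indexed by the objects of an enriched category are taken to be
  extensional (\<open>undefined\<close> off the object set), so that HOL equality is equality of
  functions and families, and uniqueness can be stated with \<open>\<exists>!\<close>.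
\<close>

record ('a, 'b, 'm) vfun =
  fobj :: "'a \<Rightarrow> 'b"
  fhom :: "'a \<Rightarrow> 'a \<Rightarrow> 'm"

definition vfunctor ::
  "('o, 'm) moncat \<Rightarrow> ('a, 'o, 'm) vcat \<Rightarrow> ('b, 'o, 'm) vcat \<Rightarrow> ('a, 'b, 'm) vfun \<Rightarrow> bool" where
  "vfunctor V C D f \<longleftrightarrow>
     fobj f \<in> vobj C \<rightarrow>\<^sub>E vobj D \<and>
     fhom f \<in> (\<Pi>\<^sub>E x\<in>vobj C. \<Pi>\<^sub>E y\<in>vobj C. hom V (vhom C x y) (vhom D (fobj f x) (fobj f y))) \<and>
     (\<forall>x\<in>vobj C. fhom f x x \<cdot>\<^bsub>V\<^esub> vid C x = vid D (fobj f x)) \<and>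
     (\<forall>x\<in>vobj C. \<forall>y\<in>vobj C. \<forall>z\<in>vobj C.
        fhom f x z \<cdot>\<^bsub>V\<^esub> vcomp C x y z =
        vcomp D (fobj f x) (fobj f y) (fobj f z) \<cdot>\<^bsub>V\<^esub> (fhom f x y \<boxtimes>\<^bsub>V\<^esub> fhom f y z))"

definition vnatural ::
  "('o, 'm) moncat \<Rightarrow> ('a, 'o, 'm) vcat \<Rightarrow> ('e, 'o, 'm) vcat \<Rightarrow>
    ('a, 'e, 'm) vfun \<Rightarrow> ('a, 'e, 'm) vfun \<Rightarrow> ('a \<Rightarrow> 'm) \<Rightarrow> bool" where
  "vnatural V C D f g \<tau> \<longleftrightarrow>
     \<tau> \<in> (\<Pi>\<^sub>E x\<in>vobj C. hom V \<I>\<^bsub>V\<^esub> (vhom D (fobj f x) (fobj g x))) \<and>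
     (\<forall>x\<in>vobj C. \<forall>y\<in>vobj C.
        vpost V D (fobj f x) (fobj f y) (fobj g y) (\<tau> y) \<cdot>\<^bsub>V\<^esub> fhom f x y =
        vpre V D (fobj f x) (fobj g x) (fobj g y) (\<tau> x) \<cdot>\<^bsub>V\<^esub> fhom g x y)"

section \<open>Relative monads\<close>

text \<open>
  The operators and equations of a relative monad. Only the object functions \<open>j\<close> and \<open>t\<close>
  are involved.
\<close>

definition extension_system ::
  "('o, 'm) moncat \<Rightarrow> ('a, 'o, 'm) vcat \<Rightarrow> ('e, 'o, 'm) vcat \<Rightarrow>
    ('a \<Rightarrow> 'e) \<Rightarrow> ('a \<Rightarrow> 'e) \<Rightarrow> ('a \<Rightarrow> 'a \<Rightarrow> 'm) \<Rightarrow> ('a \<Rightarrow> 'm) \<Rightarrow> bool" where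
  "extension_system V A E j t dag \<eta> \<longleftrightarrow>
     dag \<in> (\<Pi>\<^sub>E x\<in>vobj A. \<Pi>\<^sub>E y\<in>vobj A. hom V (vhom E (j x) (t y)) (vhom E (t x) (t y))) \<and>
     \<eta> \<in> (\<Pi>\<^sub>E x\<in>vobj A. hom V \<I>\<^bsub>V\<^esub> (vhom E (j x) (t x))) \<and>
     (\<forall>x\<in>vobj A. \<forall>y\<in>vobj A.
        vpre V E (j x) (t x) (t y) (\<eta> x) \<cdot>\<^bsub>V\<^esub> dag x y = Ident V (vhom E (j x) (t y))) \<and>
     (\<forall>x\<in>vobj A. dag x x \<cdot>\<^bsub>V\<^esub> \<eta> x = vid E (t x)) \<and>
     (\<forall>x\<in>vobj A. \<forall>y\<in>vobj A. \<forall>z\<in>vobj A.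
        vcomp E (t x) (t y) (t z) \<cdot>\<^bsub>V\<^esub> (dag x y \<boxtimes>\<^bsub>V\<^esub> dag y z) =
        dag x z \<cdot>\<^bsub>V\<^esub> vcomp E (j x) (t y) (t z) \<cdot>\<^bsub>V\<^esub> (Ident V (vhom E (j x) (t y)) \<boxtimes>\<^bsub>V\<^esub> dag y z))"

definition relative_monad ::
  "('o, 'm) moncat \<Rightarrow> ('a, 'o, 'm) vcat \<Rightarrow> ('e, 'o, 'm) vcat \<Rightarrow>
    ('a, 'e, 'm) vfun \<Rightarrow> ('a, 'e, 'm) vfun \<Rightarrow> ('a \<Rightarrow> 'a \<Rightarrow> 'm) \<Rightarrow> ('a \<Rightarrow> 'm) \<Rightarrow> bool" where
  "relative_monad V A E j t dag \<eta> \<longleftrightarrow>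
     vfunctor V A E j \<and> vfunctor V A E t \<and>
     extension_system V A E (fobj j) (fobj t) dag \<eta> \<and>
     vnatural V A E j t \<eta> \<and>
     (\<forall>x\<in>vobj A. \<forall>y\<in>vobj A. \<forall>z\<in>vobj A.
        dag x z \<cdot>\<^bsub>V\<^esub> vcomp E (fobj j x) (fobj j y) (fobj t z)
          \<cdot>\<^bsub>V\<^esub> (fhom j x y \<boxtimes>\<^bsub>V\<^esub> Ident V (vhom E (fobj j y) (fobj t z))) =
        vcomp E (fobj t x) (fobj t y) (fobj t z) \<cdot>\<^bsub>V\<^esub> (fhom t x y \<boxtimes>\<^bsub>V\<^esub> dag y z)) \<and>
     (\<forall>x\<in>vobj A. \<forall>y\<in>vobj A. \<forall>z\<in>vobj A.
        dag x z \<cdot>\<^bsub>V\<^esub> vcomp E (fobj j x) (fobj t y) (fobj t z)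
          \<cdot>\<^bsub>V\<^esub> (Ident V (vhom E (fobj j x) (fobj t y)) \<boxtimes>\<^bsub>V\<^esub> fhom t y z) =
        vcomp E (fobj t x) (fobj t y) (fobj t z) \<cdot>\<^bsub>V\<^esub> (dag x y \<boxtimes>\<^bsub>V\<^esub> fhom t y z))"

definition preserves_extension_system ::
  "('o, 'm) moncat \<Rightarrow> ('a, 'o, 'm) vcat \<Rightarrow> ('e, 'o, 'm) vcat \<Rightarrow> ('a \<Rightarrow> 'e) \<Rightarrow>
    ('a \<Rightarrow> 'e) \<Rightarrow> ('a \<Rightarrow> 'a \<Rightarrow> 'm) \<Rightarrow> ('a \<Rightarrow> 'm) \<Rightarrow>
    ('a \<Rightarrow> 'e) \<Rightarrow> ('a \<Rightarrow> 'a \<Rightarrow> 'm) \<Rightarrow> ('a \<Rightarrow> 'm) \<Rightarrow> ('a \<Rightarrow> 'm) \<Rightarrow> bool" where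
  "preserves_extension_system V A E j t dag \<eta> t' dag' \<eta>' \<tau> \<longleftrightarrow>
     (\<forall>x\<in>vobj A. vpost V E (j x) (t x) (t' x) (\<tau> x) \<cdot>\<^bsub>V\<^esub> \<eta> x = \<eta>' x) \<and>
     (\<forall>x\<in>vobj A. \<forall>y\<in>vobj A.
        vpost V E (t x) (t y) (t' y) (\<tau> y) \<cdot>\<^bsub>V\<^esub> dag x y =
        vpre V E (t x) (t' x) (t' y) (\<tau> x) \<cdot>\<^bsub>V\<^esub> dag' x y \<cdot>\<^bsub>V\<^esub> vpost V E (j x) (t y) (t' y) (\<tau> y))"

definition relative_monad_morphism ::
  "('o, 'm) moncat \<Rightarrow> ('a, 'o, 'm) vcat \<Rightarrow> ('e, 'o, 'm) vcat \<Rightarrow> ('a, 'e, 'm) vfun \<Rightarrow>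
    ('a, 'e, 'm) vfun \<Rightarrow> ('a \<Rightarrow> 'a \<Rightarrow> 'm) \<Rightarrow> ('a \<Rightarrow> 'm) \<Rightarrow>
    ('a, 'e, 'm) vfun \<Rightarrow> ('a \<Rightarrow> 'a \<Rightarrow> 'm) \<Rightarrow> ('a \<Rightarrow> 'm) \<Rightarrow> ('a \<Rightarrow> 'm) \<Rightarrow> bool" where
  "relative_monad_morphism V A E j t dag \<eta> t' dag' \<eta>' \<tau> \<longleftrightarrow>
     vnatural V A E t t' \<tau> \<and>
     preserves_extension_system V A E (fobj j) (fobj t) dag \<eta> (fobj t') dag' \<eta>' \<tau>"

end

theory Submission
  imports Defs
begin

text \<open>
  Both halves rest on the formula \<open>t x y = dag x y \<cdot> E(j x, \<eta> y) \<cdot> j x y\<close>. It is forced: by naturality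
  of \<open>\<eta>\<close> the right-hand side is \<open>dag x y \<cdot> E(\<eta> x, t y) \<cdot> t x y\<close>, and naturality (b) of \<open>dag\<close> together
  with the unit law (ii) turns this into \<open>t x y\<close>. Conversely, defining \<open>t\<close> by the formula, every
  remaining axiom follows from (i)--(iii) and the fact that postcomposing the first factor of a
  composite with \<open>h\<close> is the same as precomposing the second one with \<open>h\<close>. Naturality of a morphism \<open>\<tau>\<close>
  is then read off from the same formula, because \<open>E(j x, \<tau> y) \<cdot> E(j x, \<eta> y) = E(j x, \<eta>' y)\<close>.
\<close>

section \<open>Arrows and cancellation of isomorphisms in a category\<close>

context category
begin

lemma homD:
  assumes "f \<in> hom V x y"
  shows "f \<in> Arr V" "Dom V f = x" "Cod V f = y"
  using assms by (auto simp: hom_def)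

lemma arr_hom: "f \<in> Arr V \<Longrightarrow> f \<in> hom V (Dom V f) (Cod V f)"
  by (simp add: hom_def)

lemma comp_simps [simp]:
  assumes "f \<in> Arr V" "g \<in> Arr V" "Cod V f = Dom V g"
  shows "g \<cdot> f \<in> Arr V" "Dom V (g \<cdot> f) = Dom V f" "Cod V (g \<cdot> f) = Cod V g"
  using comp_hom[of f "Dom V f" "Dom V g" g "Cod V g"] assms by (auto simp: hom_def)

lemma ident_simps [simp]:
  assumes "x \<in> Obj V"
  shows "Ident V x \<in> Arr V" "Dom V (Ident V x) = x" "Cod V (Ident V x) = x"
  using id_hom[OF assms] by (auto simp: hom_def)

lemma id_comp_arr [simp]: "\<lbrakk>f \<in> Arr V; Cod V f = y\<rbrakk> \<Longrightarrow> Ident V y \<cdot> f = f"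
  using id_comp[of f "Dom V f" y] by (auto simp: hom_def)

lemma comp_id_arr [simp]: "\<lbrakk>f \<in> Arr V; Dom V f = x\<rbrakk> \<Longrightarrow> f \<cdot> Ident V x = f"
  using comp_id[of f x "Cod V f"] by (auto simp: hom_def)

text \<open>Composites are normalised to right-nested form. A law about an initial segment of a
  composite is therefore applied only after an explicit regrouping, which is what many equational
  steps below perform.\<close>

lemma comp_assoc_arr [simp]:
  "\<lbrakk>f \<in> Arr V; g \<in> Arr V; h \<in> Arr V; Cod V f = Dom V g; Cod V g = Dom V h\<rbrakk>
    \<Longrightarrow> (h \<cdot> g) \<cdot> f = h \<cdot> (g \<cdot> f)"
  using comp_assoc[of f "Dom V f" "Cod V f" g "Cod V g" h "Cod V h"] by (auto simp: hom_def)

lemma inverse_arrows_unique: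
  assumes "inverse_arrows V f g" "inverse_arrows V f h"
  shows "g = h"
proof -
  have "g = g \<cdot> (f \<cdot> h)"
    using assms by (auto simp: inverse_arrows_def hom_def)
  also have "\<dots> = (g \<cdot> f) \<cdot> h"
    using assms by (subst comp_assoc_arr) (auto simp: inverse_arrows_def hom_def)
  also have "\<dots> = h"
    using assms by (auto simp: inverse_arrows_def hom_def)
  finally show ?thesis .
qed

lemma inverse_arrows_inv_arr: "iso_arr V f \<Longrightarrow> inverse_arrows V f (inv_arr V f)"
  unfolding iso_arr_def inv_arr_def by (metis inverse_arrows_unique theI)

lemma inv_arr_simps [simp]:
  assumes "iso_arr V f"
  shows "inv_arr V f \<in> Arr V" "Dom V (inv_arr V f) = Cod V f" "Cod V (inv_arr V f) = Dom V f"
    "inv_arr V f \<cdot> f = Ident V (Dom V f)" "f \<cdot> inv_arr V f = Ident V (Cod V f)"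
  using inverse_arrows_inv_arr[OF assms] by (auto simp: inverse_arrows_def hom_def)

lemma iso_arr_arr: "iso_arr V f \<Longrightarrow> f \<in> Arr V"
  by (auto simp: iso_arr_def inverse_arrows_def)

lemma iso_cancel_left:
  assumes "iso_arr V f" "g \<in> Arr V" "h \<in> Arr V" "Cod V g = Dom V f" "Cod V h = Dom V f"
    and "f \<cdot> g = f \<cdot> h"
  shows "g = h"
proof -
  have "g = (inv_arr V f \<cdot> f) \<cdot> g" using assms by simp
  also have "\<dots> = inv_arr V f \<cdot> (f \<cdot> g)"
    using assms by (subst comp_assoc_arr) (auto simp: iso_arr_arr)
  also have "\<dots> = (inv_arr V f \<cdot> f) \<cdot> h"
    using assms by (subst comp_assoc_arr) (auto simp: iso_arr_arr)
  also have "\<dots> = h" using assms by simp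
  finally show ?thesis .
qed

lemma iso_cancel_right:
  assumes "iso_arr V f" "g \<in> Arr V" "h \<in> Arr V" "Dom V g = Cod V f" "Dom V h = Cod V f"
    and "g \<cdot> f = h \<cdot> f"
  shows "g = h"
proof -
  have "g = (g \<cdot> f) \<cdot> inv_arr V f" using assms(1-5) by (simp add: iso_arr_arr)
  also have "\<dots> = h" using assms(1-5) unfolding assms(6) by (simp add: iso_arr_arr)
  finally show ?thesis .
qed

end

section \<open>Coherence of the unit isomorphisms in a monoidal category\<close>

context monoidal_category
begin

lemma tensor_simps [simp]:
  assumes "f \<in> Arr V" "g \<in> Arr V"
  shows "f \<boxtimes> g \<in> Arr V" "Dom V (f \<boxtimes> g) = Dom V f \<otimes> Dom V g"
    "Cod V (f \<boxtimes> g) = Cod V f \<otimes> Cod V g"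
  using tensor_hom[OF arr_hom arr_hom, OF assms] by (auto simp: hom_def)

declare unit_obj [simp] tensor_obj [simp] tensor_id [simp] dom_obj [simp] cod_obj [simp]

lemma structure_simps [simp]:
  "\<lbrakk>x \<in> Obj V; y \<in> Obj V; z \<in> Obj V\<rbrakk> \<Longrightarrow> assoc V x y z \<in> Arr V"
  "\<lbrakk>x \<in> Obj V; y \<in> Obj V; z \<in> Obj V\<rbrakk> \<Longrightarrow> Dom V (assoc V x y z) = (x \<otimes> y) \<otimes> z"
  "\<lbrakk>x \<in> Obj V; y \<in> Obj V; z \<in> Obj V\<rbrakk> \<Longrightarrow> Cod V (assoc V x y z) = x \<otimes> (y \<otimes> z)"
  "x \<in> Obj V \<Longrightarrow> lunit V x \<in> Arr V"
  "x \<in> Obj V \<Longrightarrow> Dom V (lunit V x) = \<I> \<otimes> x"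
  "x \<in> Obj V \<Longrightarrow> Cod V (lunit V x) = x"
  "x \<in> Obj V \<Longrightarrow> runit V x \<in> Arr V"
  "x \<in> Obj V \<Longrightarrow> Dom V (runit V x) = x \<otimes> \<I>"
  "x \<in> Obj V \<Longrightarrow> Cod V (runit V x) = x"
  using assoc_hom lunit_hom runit_hom by (auto simp: hom_def)

declare assoc_iso [simp] lunit_iso [simp] runit_iso [simp]

lemma interchange:
  assumes "f \<in> Arr V" "g \<in> Arr V" "f' \<in> Arr V" "g' \<in> Arr V"
    "Cod V f = Dom V g" "Cod V f' = Dom V g'"
  shows "(g \<boxtimes> g') \<cdot> (f \<boxtimes> f') = (g \<cdot> f) \<boxtimes> (g' \<cdot> f')"
  using tensor_comp[of f "Dom V f" "Dom V g" g "Cod V g" f' "Dom V f'" "Dom V g'" g' "Cod V g'"]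
    assms by (auto simp: hom_def)

lemma interchange_comp:
  assumes "f \<in> Arr V" "g \<in> Arr V" "f' \<in> Arr V" "g' \<in> Arr V"
    "Cod V f = Dom V g" "Cod V f' = Dom V g'" "k \<in> Arr V" "Cod V k = Dom V f \<otimes> Dom V f'"
  shows "(g \<boxtimes> g') \<cdot> ((f \<boxtimes> f') \<cdot> k) = ((g \<cdot> f) \<boxtimes> (g' \<cdot> f')) \<cdot> k"
  using assms by (simp flip: interchange)

text \<open>By naturality, \<open>f \<cdot> runit V x\<close> depends only on
  \<open>f \<boxtimes> Ident V \<I>\<close>, and \<open>runit V x\<close> is invertible.\<close>

lemma tensor_unit_right_cancel:
  assumes "f \<in> hom V x y" "g \<in> hom V x y" "f \<boxtimes> Ident V \<I> = g \<boxtimes> Ident V \<I>"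
  shows "f = g"
proof (rule iso_cancel_right[of "runit V x"])
  show "f \<cdot> runit V x = g \<cdot> runit V x"
    using runit_natural[OF assms(1)] runit_natural[OF assms(2)] assms(3) by simp
qed (use homD[OF assms(1)] homD[OF assms(2)] dom_obj[of f] in auto)

lemma tensor_unit_left_cancel:
  assumes "f \<in> hom V x y" "g \<in> hom V x y" "Ident V \<I> \<boxtimes> f = Ident V \<I> \<boxtimes> g"
  shows "f = g"
proof (rule iso_cancel_right[of "lunit V x"])
  show "f \<cdot> lunit V x = g \<cdot> lunit V x"
    using lunit_natural[OF assms(1)] lunit_natural[OF assms(2)] assms(3) by simp
qed (use homD[OF assms(1)] homD[OF assms(2)] dom_obj[of f] in auto)

text \<open>
  Kelly's argument: tensoring with the unit object is faithful, and after tensoring the claim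
  follows from the pentagon at \<open>x, y, \<I>, \<I>\<close> and the triangle.
\<close>

lemma runit_tensor:
  assumes [simp]: "x \<in> Obj V" "y \<in> Obj V"
  shows "(Ident V x \<boxtimes> runit V y) \<cdot> assoc V x y \<I> = runit V (x \<otimes> y)"
proof (rule tensor_unit_right_cancel)
  let ?a = "assoc V x y \<I>"
  show "((Ident V x \<boxtimes> runit V y) \<cdot> ?a) \<boxtimes> Ident V \<I> = runit V (x \<otimes> y) \<boxtimes> Ident V \<I>"
  proof (rule iso_cancel_left[of ?a])
    have "?a \<cdot> (runit V (x \<otimes> y) \<boxtimes> Ident V \<I>)
        = ?a \<cdot> ((Ident V x \<boxtimes> Ident V y) \<boxtimes> lunit V \<I>) \<cdot> assoc V (x \<otimes> y) \<I> \<I>"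
      by (simp flip: triangle)
    also have "\<dots> = (?a \<cdot> ((Ident V x \<boxtimes> Ident V y) \<boxtimes> lunit V \<I>)) \<cdot> assoc V (x \<otimes> y) \<I> \<I>"
      by simp
    also have "?a \<cdot> ((Ident V x \<boxtimes> Ident V y) \<boxtimes> lunit V \<I>)
        = (Ident V x \<boxtimes> (Ident V y \<boxtimes> lunit V \<I>)) \<cdot> assoc V x y (\<I> \<otimes> \<I>)"
      by (intro assoc_natural id_hom lunit_hom) auto
    also have "\<dots> \<cdot> assoc V (x \<otimes> y) \<I> \<I> = (Ident V x \<boxtimes> (Ident V y \<boxtimes> lunit V \<I>)) \<cdot>
        (Ident V x \<boxtimes> assoc V y \<I> \<I>) \<cdot> assoc V x (y \<otimes> \<I>) \<I> \<cdot> (?a \<boxtimes> Ident V \<I>)"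
      by (simp add: pentagon)
    also have "\<dots> = (Ident V x \<boxtimes> (runit V y \<boxtimes> Ident V \<I>)) \<cdot>
        assoc V x (y \<otimes> \<I>) \<I> \<cdot> (?a \<boxtimes> Ident V \<I>)"
      by (simp add: interchange_comp triangle)
    also have "\<dots> = ((Ident V x \<boxtimes> (runit V y \<boxtimes> Ident V \<I>)) \<cdot>
        assoc V x (y \<otimes> \<I>) \<I>) \<cdot> (?a \<boxtimes> Ident V \<I>)"
      by simp
    also have "(Ident V x \<boxtimes> (runit V y \<boxtimes> Ident V \<I>)) \<cdot> assoc V x (y \<otimes> \<I>) \<I>
        = ?a \<cdot> ((Ident V x \<boxtimes> runit V y) \<boxtimes> Ident V \<I>)"
      by (rule assoc_natural[symmetric]; intro id_hom runit_hom) auto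
    also have "\<dots> \<cdot> (?a \<boxtimes> Ident V \<I>) = ?a \<cdot> (((Ident V x \<boxtimes> runit V y) \<cdot> ?a) \<boxtimes> Ident V \<I>)"
      by (simp add: interchange)
    finally show "?a \<cdot> (((Ident V x \<boxtimes> runit V y) \<cdot> ?a) \<boxtimes> Ident V \<I>)
        = ?a \<cdot> (runit V (x \<otimes> y) \<boxtimes> Ident V \<I>)" ..
  qed simp_all
qed (auto simp: hom_def)

text \<open>After cancelling the unit on the left it suffices to compare the two sides precomposed
  with the associator. There \<open>runit_tensor\<close> turns one into
  \<open>runit V (\<I> \<otimes> \<I>)\<close> and the triangle turns the other into
  \<open>runit V \<I> \<boxtimes> Ident V \<I>\<close>.\<close>

lemma runit_unit: "runit V \<I> = lunit V \<I>"
proof (rule tensor_unit_left_cancel)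
  \<comment> \<open>This is naturality of \<open>runit\<close> at the arrow
    \<open>runit V \<I>\<close> itself, with that isomorphism cancelled.\<close>
  have *: "runit V (\<I> \<otimes> \<I>) = runit V \<I> \<boxtimes> Ident V \<I>"
    by (rule iso_cancel_left[of "runit V \<I>"])
      (use runit_natural[OF runit_hom[OF unit_obj]] in auto)
  show "Ident V \<I> \<boxtimes> runit V \<I> = Ident V \<I> \<boxtimes> lunit V \<I>"
    by (rule iso_cancel_right[of "assoc V \<I> \<I> \<I>"]) (auto simp: * runit_tensor triangle)
qed (auto simp: hom_def)

lemma inv_lunit_natural:
  assumes "f \<in> Arr V" "Dom V f = x" "Cod V f = y"
  shows "inv_arr V (lunit V y) \<cdot> f = (Ident V \<I> \<boxtimes> f) \<cdot> inv_arr V (lunit V x)"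
proof (rule iso_cancel_left[of "lunit V y"])
  have [simp]: "x \<in> Obj V" "y \<in> Obj V" using assms by auto
  have "lunit V y \<cdot> (Ident V \<I> \<boxtimes> f) \<cdot> inv_arr V (lunit V x)
      = (lunit V y \<cdot> (Ident V \<I> \<boxtimes> f)) \<cdot> inv_arr V (lunit V x)"
    using assms by simp
  also have "\<dots> = f"
    using assms lunit_natural[of f x y] by (simp add: hom_def)
  also have "f = lunit V y \<cdot> inv_arr V (lunit V y) \<cdot> f"
    using assms by (simp flip: comp_assoc_arr)
  finally show "lunit V y \<cdot> inv_arr V (lunit V y) \<cdot> f
      = lunit V y \<cdot> (Ident V \<I> \<boxtimes> f) \<cdot> inv_arr V (lunit V x)" ..
qed (use assms in auto)

lemma inv_runit_natural:
  assumes "f \<in> Arr V" "Dom V f = x" "Cod V f = y"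
  shows "inv_arr V (runit V y) \<cdot> f = (f \<boxtimes> Ident V \<I>) \<cdot> inv_arr V (runit V x)"
proof (rule iso_cancel_left[of "runit V y"])
  have [simp]: "x \<in> Obj V" "y \<in> Obj V" using assms by auto
  have "runit V y \<cdot> (f \<boxtimes> Ident V \<I>) \<cdot> inv_arr V (runit V x)
      = (runit V y \<cdot> (f \<boxtimes> Ident V \<I>)) \<cdot> inv_arr V (runit V x)"
    using assms by simp
  also have "\<dots> = f"
    using assms runit_natural[of f x y] by (simp add: hom_def)
  also have "f = runit V y \<cdot> inv_arr V (runit V y) \<cdot> f"
    using assms by (simp flip: comp_assoc_arr)
  finally show "runit V y \<cdot> inv_arr V (runit V y) \<cdot> f
      = runit V y \<cdot> (f \<boxtimes> Ident V \<I>) \<cdot> inv_arr V (runit V x)" ..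
qed (use assms in auto)

text \<open>The inverse form of \<open>runit_tensor\<close>. It is the form needed for
  \<open>vpost\<close>, whose definition starts with an inverse right unitor.\<close>

lemma assoc_inv_runit:
  assumes [simp]: "x \<in> Obj V" "y \<in> Obj V"
  shows "assoc V x y \<I> \<cdot> inv_arr V (runit V (x \<otimes> y)) = Ident V x \<boxtimes> inv_arr V (runit V y)"
proof -
  let ?r = "Ident V x \<boxtimes> runit V y" and ?s = "Ident V x \<boxtimes> inv_arr V (runit V y)"
  have "?s \<cdot> ?r \<cdot> assoc V x y \<I> \<cdot> inv_arr V (runit V (x \<otimes> y))
      = ?s \<cdot> (?r \<cdot> assoc V x y \<I>) \<cdot> inv_arr V (runit V (x \<otimes> y))"
    by simp
  also have "\<dots> = ?s"
    unfolding runit_tensor[OF assms] by simp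
  finally show ?thesis
    by (simp add: interchange_comp)
qed

text \<open>The inverse form of the triangle: it exchanges the inverse right unitor of a
  \<open>vpost\<close> on the first factor for the inverse left unitor of a \<open>vpre\<close> on
  the second.\<close>

lemma assoc_inv_runit_tensor:
  assumes [simp]: "x \<in> Obj V" "y \<in> Obj V"
  shows "assoc V x \<I> y \<cdot> (inv_arr V (runit V x) \<boxtimes> Ident V y)
      = Ident V x \<boxtimes> inv_arr V (lunit V y)"
proof -
  let ?l = "Ident V x \<boxtimes> lunit V y" and ?s = "Ident V x \<boxtimes> inv_arr V (lunit V y)"
  let ?r = "inv_arr V (runit V x) \<boxtimes> Ident V y"
  have "?s \<cdot> ?l \<cdot> assoc V x \<I> y \<cdot> ?r = ?s \<cdot> (?l \<cdot> assoc V x \<I> y) \<cdot> ?r"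
    by simp
  also have "\<dots> = ?s"
    unfolding triangle[OF assms] by (simp add: interchange)
  finally show ?thesis
    by (simp add: interchange_comp)
qed

end

section \<open>Pre- and postcomposition with elements of hom-objects\<close>

context vcategory
begin

lemma vhom_simps [simp]:
  "\<lbrakk>x \<in> vobj C; y \<in> vobj C\<rbrakk> \<Longrightarrow> vhom C x y \<in> Obj V"
  "x \<in> vobj C \<Longrightarrow> vid C x \<in> Arr V"
  "x \<in> vobj C \<Longrightarrow> Dom V (vid C x) = \<I>"
  "x \<in> vobj C \<Longrightarrow> Cod V (vid C x) = vhom C x x"
  "\<lbrakk>x \<in> vobj C; y \<in> vobj C; z \<in> vobj C\<rbrakk> \<Longrightarrow> vcomp C x y z \<in> Arr V"
  "\<lbrakk>x \<in> vobj C; y \<in> vobj C; z \<in> vobj C\<rbrakk> \<Longrightarrow> Dom V (vcomp C x y z) = vhom C x y \<otimes> vhom C y z"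
  "\<lbrakk>x \<in> vobj C; y \<in> vobj C; z \<in> vobj C\<rbrakk> \<Longrightarrow> Cod V (vcomp C x y z) = vhom C x z"
  using vhom_obj vid_hom vcomp_hom by (auto simp: hom_def)

lemma vpost_simps [simp]:
  assumes "h \<in> Arr V" "Dom V h = \<I>" "Cod V h = vhom C b c" "a \<in> vobj C" "b \<in> vobj C" "c \<in> vobj C"
  shows "vpost V C a b c h \<in> Arr V" "Dom V (vpost V C a b c h) = vhom C a b"
    "Cod V (vpost V C a b c h) = vhom C a c"
  using assms by (simp_all add: vpost_def)

lemma vpre_simps [simp]:
  assumes "h \<in> Arr V" "Dom V h = \<I>" "Cod V h = vhom C b c" "b \<in> vobj C" "c \<in> vobj C" "d \<in> vobj C"
  shows "vpre V C b c d h \<in> Arr V" "Dom V (vpre V C b c d h) = vhom C c d"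
    "Cod V (vpre V C b c d h) = vhom C b d"
  using assms by (simp_all add: vpre_def)

text \<open>Associativity of composition with \<open>h\<close> inserted as the third factor.
  Naturality moves the associator past \<open>h\<close>, and \<open>assoc_inv_runit\<close> absorbs
  it into the unitor.\<close>

lemma vpost_vcomp:
  assumes [simp]: "h \<in> Arr V" "Dom V h = \<I>" "Cod V h = vhom C c d"
    and [simp]: "a \<in> vobj C" "b \<in> vobj C" "c \<in> vobj C" "d \<in> vobj C"
  shows "vpost V C a c d h \<cdot> vcomp C a b c
      = vcomp C a b d \<cdot> (Ident V (vhom C a b) \<boxtimes> vpost V C b c d h)"
proof -
  let ?X = "vhom C a b" and ?Y = "vhom C b c" and ?Z = "vhom C c d"
  let ?r = "inv_arr V (runit V (?X \<otimes> ?Y))"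
  have "vpost V C a c d h \<cdot> vcomp C a b c
      = vcomp C a c d \<cdot> (Ident V (vhom C a c) \<boxtimes> h) \<cdot> (vcomp C a b c \<boxtimes> Ident V \<I>) \<cdot> ?r"
    by (simp add: vpost_def inv_runit_natural)
  also have "\<dots> = (vcomp C a c d \<cdot> (vcomp C a b c \<boxtimes> Ident V ?Z)) \<cdot> (Ident V (?X \<otimes> ?Y) \<boxtimes> h) \<cdot> ?r"
    by (simp add: interchange_comp)
  also have "\<dots> = vcomp C a b d \<cdot> (Ident V ?X \<boxtimes> vcomp C b c d) \<cdot>
      (assoc V ?X ?Y ?Z \<cdot> ((Ident V ?X \<boxtimes> Ident V ?Y) \<boxtimes> h)) \<cdot> ?r"
    by (simp add: vcomp_assoc)
  also have "assoc V ?X ?Y ?Z \<cdot> ((Ident V ?X \<boxtimes> Ident V ?Y) \<boxtimes> h)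
      = (Ident V ?X \<boxtimes> (Ident V ?Y \<boxtimes> h)) \<cdot> assoc V ?X ?Y \<I>"
    by (intro assoc_natural id_hom) (auto simp: hom_def)
  finally show ?thesis
    by (simp add: vpost_def assoc_inv_runit interchange)
qed

text \<open>Associativity of composition again, now with \<open>h\<close> inserted as the middle
  factor; the associator is absorbed by \<open>assoc_inv_runit_tensor\<close>.\<close>

lemma vcomp_vpre:
  assumes [simp]: "h \<in> Arr V" "Dom V h = \<I>" "Cod V h = vhom C b c"
    and [simp]: "a \<in> vobj C" "b \<in> vobj C" "c \<in> vobj C" "d \<in> vobj C"
  shows "vcomp C a b d \<cdot> (Ident V (vhom C a b) \<boxtimes> vpre V C b c d h)
      = vcomp C a c d \<cdot> (vpost V C a b c h \<boxtimes> Ident V (vhom C c d))"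
proof -
  let ?X = "vhom C a b" and ?Y = "vhom C b c" and ?Z = "vhom C c d"
  let ?r = "inv_arr V (runit V ?X) \<boxtimes> Ident V ?Z"
  have "vcomp C a c d \<cdot> (vpost V C a b c h \<boxtimes> Ident V ?Z)
      = (vcomp C a c d \<cdot> (vcomp C a b c \<boxtimes> Ident V ?Z)) \<cdot> ((Ident V ?X \<boxtimes> h) \<boxtimes> Ident V ?Z) \<cdot> ?r"
    by (simp add: vpost_def interchange)
  also have "\<dots> = vcomp C a b d \<cdot> (Ident V ?X \<boxtimes> vcomp C b c d) \<cdot>
      (assoc V ?X ?Y ?Z \<cdot> ((Ident V ?X \<boxtimes> h) \<boxtimes> Ident V ?Z)) \<cdot> ?r"
    by (simp add: vcomp_assoc)
  also have "assoc V ?X ?Y ?Z \<cdot> ((Ident V ?X \<boxtimes> h) \<boxtimes> Ident V ?Z)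
      = (Ident V ?X \<boxtimes> (h \<boxtimes> Ident V ?Z)) \<cdot> assoc V ?X \<I> ?Z"
    by (intro assoc_natural id_hom) (auto simp: hom_def)
  finally show ?thesis
    by (simp add: vpre_def assoc_inv_runit_tensor interchange)
qed

lemma vpre_vid:
  assumes [simp]: "x \<in> vobj C" "y \<in> vobj C"
  shows "vpre V C x x y (vid C x) = Ident V (vhom C x y)"
proof -
  have "vpre V C x x y (vid C x)
      = (vcomp C x x y \<cdot> (vid C x \<boxtimes> Ident V (vhom C x y))) \<cdot> inv_arr V (lunit V (vhom C x y))"
    by (simp add: vpre_def)
  also have "\<dots> = Ident V (vhom C x y)"
    unfolding vid_left[OF assms] by simp
  finally show ?thesis .
qed

lemma vpost_comp_vid:
  assumes [simp]: "h \<in> Arr V" "Dom V h = \<I>" "Cod V h = vhom C x y" "x \<in> vobj C" "y \<in> vobj C"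
  shows "vpost V C x x y h \<cdot> vid C x = h"
proof -
  \<comment> \<open>Sliding \<open>vid C x\<close> past the inverse right unitor leaves that unitor
    at \<open>\<I>\<close>, where \<open>runit_unit\<close> makes it the left one. The resulting
    middle term can then be read as a precomposition with the identity.\<close>
  have "vpost V C x x y h \<cdot> vid C x
      = vcomp C x x y \<cdot> (vid C x \<boxtimes> h) \<cdot> inv_arr V (lunit V \<I>)"
    by (simp add: vpost_def inv_runit_natural interchange_comp runit_unit)
  also have "\<dots> = vpre V C x x y (vid C x) \<cdot> h"
    by (simp add: vpre_def inv_lunit_natural interchange_comp)
  also have "\<dots> = h"
    by (simp add: vpre_vid)
  finally show ?thesis .
qed

text \<open>Functoriality of postcomposition: \<open>vpost_vcomp\<close> with the element
  \<open>k\<close> inserted in the second factor.\<close>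

lemma vpost_vpost:
  assumes [simp]: "h \<in> Arr V" "Dom V h = \<I>" "Cod V h = vhom C c d"
    and [simp]: "k \<in> Arr V" "Dom V k = \<I>" "Cod V k = vhom C b c"
    and [simp]: "a \<in> vobj C" "b \<in> vobj C" "c \<in> vobj C" "d \<in> vobj C"
  shows "vpost V C a b d (vpost V C b c d h \<cdot> k) = vpost V C a c d h \<cdot> vpost V C a b c k"
proof -
  let ?X = "vhom C a b"
  let ?k = "(Ident V ?X \<boxtimes> k) \<cdot> inv_arr V (runit V ?X)"
  have "vpost V C a b d (vpost V C b c d h \<cdot> k)
      = (vcomp C a b d \<cdot> (Ident V ?X \<boxtimes> vpost V C b c d h)) \<cdot> ?k"
    by (simp add: vpost_def[of V C a b d] interchange_comp)
  also have "\<dots> = (vpost V C a c d h \<cdot> vcomp C a b c) \<cdot> ?k"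
    by (simp add: vpost_vcomp)
  also have "\<dots> = vpost V C a c d h \<cdot> vpost V C a b c k"
    by (simp add: vpost_def[of V C a b c])
  finally show ?thesis .
qed

end

section \<open>The functor and the relative monad determined by an extension system\<close>

lemma vfunctor_simps:
  assumes "vfunctor V C D f" "x \<in> vobj C"
  shows "fobj f x \<in> vobj D"
    and "y \<in> vobj C \<Longrightarrow> fhom f x y \<in> Arr V"
    and "y \<in> vobj C \<Longrightarrow> Dom V (fhom f x y) = vhom C x y"
    and "y \<in> vobj C \<Longrightarrow> Cod V (fhom f x y) = vhom D (fobj f x) (fobj f y)"
  using assms unfolding vfunctor_def PiE_iff hom_def by auto

text \<open>Only the object function of \<open>t\<close> is given here. The locale thus serves
  arbitrary data satisfying (i)-(iii) as well as the data underlying a given relative monad.\<close>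

locale extension_data = A: vcategory V A + E: vcategory V E
  for V :: "('o, 'm) moncat" (structure)
    and A :: "('a, 'o, 'm) vcat" and E :: "('e, 'o, 'm) vcat" +
  fixes j :: "('a, 'e, 'm) vfun" and t :: "'a \<Rightarrow> 'e" and dag :: "'a \<Rightarrow> 'a \<Rightarrow> 'm" and \<eta> :: "'a \<Rightarrow> 'm"
  assumes root: "vfunctor V A E j"
    and t_obj: "t \<in> vobj A \<rightarrow>\<^sub>E vobj E"
    and extension: "extension_system V A E (fobj j) t dag \<eta>"
begin

lemmas root_simps [simp] = vfunctor_simps[OF root]

lemma t_simps [simp]: "x \<in> vobj A \<Longrightarrow> t x \<in> vobj E"
  using t_obj by auto

lemma dag_simps [simp]:
  assumes "x \<in> vobj A" "y \<in> vobj A"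
  shows "dag x y \<in> Arr V" "Dom V (dag x y) = vhom E (fobj j x) (t y)"
    "Cod V (dag x y) = vhom E (t x) (t y)"
  using extension assms unfolding extension_system_def PiE_iff hom_def by auto

lemma eta_simps [simp]:
  assumes "x \<in> vobj A"
  shows "\<eta> x \<in> Arr V" "Dom V (\<eta> x) = \<I>" "Cod V (\<eta> x) = vhom E (fobj j x) (t x)"
  using extension assms unfolding extension_system_def PiE_iff hom_def by auto

lemma vpre_eta_dag:
  "\<lbrakk>x \<in> vobj A; y \<in> vobj A\<rbrakk>
    \<Longrightarrow> vpre V E (fobj j x) (t x) (t y) (\<eta> x) \<cdot> dag x y = Ident V (vhom E (fobj j x) (t y))"
  using extension by (simp add: extension_system_def)

lemma dag_eta: "x \<in> vobj A \<Longrightarrow> dag x x \<cdot> \<eta> x = vid E (t x)"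
  using extension by (simp add: extension_system_def)

lemma vcomp_dag_dag:
  "\<lbrakk>x \<in> vobj A; y \<in> vobj A; z \<in> vobj A\<rbrakk>
    \<Longrightarrow> vcomp E (t x) (t y) (t z) \<cdot> (dag x y \<boxtimes> dag y z) =
        dag x z \<cdot> vcomp E (fobj j x) (t y) (t z) \<cdot> (Ident V (vhom E (fobj j x) (t y)) \<boxtimes> dag y z)"
  using extension by (simp add: extension_system_def)

text \<open>With \<open>E(j x, t y)\<close> viewed as the hom-object of the Kleisli category, this
  is the action on homs of the Kleisli inclusion of \<open>A\<close>. Applying \<open>dag\<close> to
  it yields the action of \<open>t\<close>.\<close>

definition unit_hom :: "'a \<Rightarrow> 'a \<Rightarrow> 'm" where
  "unit_hom x y = vpost V E (fobj j x) (fobj j y) (t y) (\<eta> y) \<cdot> fhom j x y"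

lemma unit_hom_simps [simp]:
  assumes "x \<in> vobj A" "y \<in> vobj A"
  shows "unit_hom x y \<in> Arr V" "Dom V (unit_hom x y) = vhom A x y"
    "Cod V (unit_hom x y) = vhom E (fobj j x) (t y)"
  using assms by (simp_all add: unit_hom_def)

text \<open>By \<open>vcomp_vpre\<close> the unit \<open>\<eta> y\<close> inside
  \<open>unit_hom x y\<close> crosses to the second factor, where it cancels \<open>dag y z\<close>
  by (i).\<close>

lemma vcomp_unit_hom_dag:
  assumes [simp]: "x \<in> vobj A" "y \<in> vobj A" "z \<in> vobj A"
  shows "vcomp E (fobj j x) (t y) (t z) \<cdot> (unit_hom x y \<boxtimes> dag y z)
      = vcomp E (fobj j x) (fobj j y) (t z) \<cdot> (fhom j x y \<boxtimes> Ident V (vhom E (fobj j y) (t z)))"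
proof -
  let ?X = "vhom E (fobj j x) (fobj j y)"
  let ?p = "vpost V E (fobj j x) (fobj j y) (t y) (\<eta> y)"
  have "vcomp E (fobj j x) (t y) (t z) \<cdot> (unit_hom x y \<boxtimes> dag y z)
      = (vcomp E (fobj j x) (t y) (t z) \<cdot> (?p \<boxtimes> Ident V (vhom E (t y) (t z)))) \<cdot>
          (fhom j x y \<boxtimes> dag y z)"
    by (simp add: unit_hom_def A.interchange)
  also have "\<dots> = (vcomp E (fobj j x) (fobj j y) (t z) \<cdot>
      (Ident V ?X \<boxtimes> vpre V E (fobj j y) (t y) (t z) (\<eta> y))) \<cdot> (fhom j x y \<boxtimes> dag y z)"
    by (simp add: E.vcomp_vpre)
  also have "\<dots> = vcomp E (fobj j x) (fobj j y) (t z) \<cdot>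
      (fhom j x y \<boxtimes> Ident V (vhom E (fobj j y) (t z)))"
    by (simp add: A.interchange vpre_eta_dag)
  finally show ?thesis .
qed

text \<open>Naturality (a) of \<open>dag\<close> for the functor about to be defined. Law (iii),
  precomposed with \<open>unit_hom x y\<close> in the first factor, reduces it to
  \<open>vcomp_unit_hom_dag\<close>.\<close>

lemma dag_vcomp_root:
  assumes [simp]: "x \<in> vobj A" "y \<in> vobj A" "z \<in> vobj A"
  shows "dag x z \<cdot> vcomp E (fobj j x) (fobj j y) (t z) \<cdot>
        (fhom j x y \<boxtimes> Ident V (vhom E (fobj j y) (t z)))
      = vcomp E (t x) (t y) (t z) \<cdot> ((dag x y \<cdot> unit_hom x y) \<boxtimes> dag y z)"
proof -
  let ?Z = "vhom E (fobj j y) (t z)"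
  have "vcomp E (t x) (t y) (t z) \<cdot> ((dag x y \<cdot> unit_hom x y) \<boxtimes> dag y z)
      = (vcomp E (t x) (t y) (t z) \<cdot> (dag x y \<boxtimes> dag y z)) \<cdot> (unit_hom x y \<boxtimes> Ident V ?Z)"
    by (simp add: A.interchange)
  also have "\<dots> = dag x z \<cdot> vcomp E (fobj j x) (t y) (t z) \<cdot> (unit_hom x y \<boxtimes> dag y z)"
    by (simp add: vcomp_dag_dag A.interchange)
  finally show ?thesis
    by (simp add: vcomp_unit_hom_dag)
qed

text \<open>The nested restrictions make the hom family extensional in both arguments, as
  \<open>vfunctor\<close> demands.\<close>

definition extension_vfun :: "('a, 'e, 'm) vfun" where
  "extension_vfun = \<lparr>fobj = t, fhom = (\<lambda>x\<in>vobj A. \<lambda>y\<in>vobj A. dag x y \<cdot> unit_hom x y)\<rparr>"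

lemma fobj_extension_vfun [simp]: "fobj extension_vfun = t"
  by (simp add: extension_vfun_def)

lemma fhom_extension_vfun [simp]:
  "\<lbrakk>x \<in> vobj A; y \<in> vobj A\<rbrakk> \<Longrightarrow> fhom extension_vfun x y = dag x y \<cdot> unit_hom x y"
  by (simp add: extension_vfun_def)

text \<open>Since \<open>j\<close> preserves identities, \<open>unit_hom x x\<close> sends the
  identity to \<open>\<eta> x\<close>, and (ii) applies.\<close>

lemma dag_unit_hom_vid:
  assumes [simp]: "x \<in> vobj A"
  shows "dag x x \<cdot> unit_hom x x \<cdot> vid A x = vid E (t x)"
proof -
  have "fhom j x x \<cdot> vid A x = vid E (fobj j x)"
    using root by (simp add: vfunctor_def)
  then show ?thesis
    by (simp add: unit_hom_def E.vpost_comp_vid dag_eta)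
qed

text \<open>Since \<open>j\<close> preserves composition, \<open>vpost_vcomp\<close> can push
  \<open>\<eta> z\<close> onto the second factor, forming \<open>unit_hom y z\<close>. What remains
  is naturality (a), precomposed with \<open>unit_hom y z\<close> in the second factor.\<close>

lemma dag_unit_hom_vcomp:
  assumes [simp]: "x \<in> vobj A" "y \<in> vobj A" "z \<in> vobj A"
  shows "dag x z \<cdot> unit_hom x z \<cdot> vcomp A x y z
      = vcomp E (t x) (t y) (t z) \<cdot> ((dag x y \<cdot> unit_hom x y) \<boxtimes> (dag y z \<cdot> unit_hom y z))"
proof -
  let ?p = "\<lambda>x. vpost V E (fobj j x) (fobj j z) (t z) (\<eta> z)"
  let ?M = "vcomp E (fobj j x) (fobj j y)"
  have "fhom j x z \<cdot> vcomp A x y z = ?M (fobj j z) \<cdot> (fhom j x y \<boxtimes> fhom j y z)"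
    using root by (simp add: vfunctor_def)
  then have "dag x z \<cdot> unit_hom x z \<cdot> vcomp A x y z
      = dag x z \<cdot> (?p x \<cdot> ?M (fobj j z)) \<cdot> (fhom j x y \<boxtimes> fhom j y z)"
    by (simp add: unit_hom_def)
  also have "\<dots> = dag x z \<cdot> ?M (t z) \<cdot> (fhom j x y \<boxtimes> unit_hom y z)"
    by (simp add: E.vpost_vcomp A.interchange unit_hom_def)
  also have "\<dots> = (dag x z \<cdot> ?M (t z) \<cdot> (fhom j x y \<boxtimes> Ident V (vhom E (fobj j y) (t z)))) \<cdot>
      (Ident V (vhom A x y) \<boxtimes> unit_hom y z)"
    by (simp add: A.interchange)
  also have "\<dots> = vcomp E (t x) (t y) (t z) \<cdot>
      ((dag x y \<cdot> unit_hom x y) \<boxtimes> (dag y z \<cdot> unit_hom y z))"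
    unfolding dag_vcomp_root[OF assms] by (simp add: A.interchange)
  finally show ?thesis .
qed

lemma vfunctor_extension_vfun: "vfunctor V A E extension_vfun"
  unfolding vfunctor_def
  by (auto simp: t_obj extension_vfun_def hom_def dag_unit_hom_vid dag_unit_hom_vcomp)

text \<open>Naturality of \<open>\<eta>\<close> for the constructed functor comes down to this
  consequence of (i), because the other side of the naturality square is \<open>unit_hom x y\<close>
  by definition.\<close>

lemma vpre_eta_dag_unit_hom:
  assumes [simp]: "x \<in> vobj A" "y \<in> vobj A"
  shows "vpre V E (fobj j x) (t x) (t y) (\<eta> x) \<cdot> dag x y \<cdot> unit_hom x y = unit_hom x y"
proof -
  have "(vpre V E (fobj j x) (t x) (t y) (\<eta> x) \<cdot> dag x y) \<cdot> unit_hom x y = unit_hom x y"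
    unfolding vpre_eta_dag[OF assms] by simp
  then show ?thesis
    by simp
qed

lemma vnatural_eta: "vnatural V A E j extension_vfun \<eta>"
  using extension
  by (simp add: vnatural_def vpre_eta_dag_unit_hom extension_system_def flip: unit_hom_def)

text \<open>Naturality (b) of \<open>dag\<close>: law (iii) precomposed with
  \<open>unit_hom y z\<close> in the second factor.\<close>

lemma dag_vcomp_dag_unit_hom:
  assumes [simp]: "x \<in> vobj A" "y \<in> vobj A" "z \<in> vobj A"
  shows "dag x z \<cdot> vcomp E (fobj j x) (t y) (t z) \<cdot>
        (Ident V (vhom E (fobj j x) (t y)) \<boxtimes> (dag y z \<cdot> unit_hom y z))
      = vcomp E (t x) (t y) (t z) \<cdot> (dag x y \<boxtimes> (dag y z \<cdot> unit_hom y z))"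
proof -
  let ?u = "Ident V (vhom E (fobj j x) (t y)) \<boxtimes> unit_hom y z"
  have "vcomp E (t x) (t y) (t z) \<cdot> (dag x y \<boxtimes> (dag y z \<cdot> unit_hom y z))
      = (vcomp E (t x) (t y) (t z) \<cdot> (dag x y \<boxtimes> dag y z)) \<cdot> ?u"
    by (simp add: A.interchange)
  then show ?thesis
    by (simp add: vcomp_dag_dag A.interchange)
qed

lemma relative_monad_extension_vfun: "relative_monad V A E j extension_vfun dag \<eta>"
  unfolding relative_monad_def
  by (simp add: root vfunctor_extension_vfun extension vnatural_eta dag_vcomp_root dag_vcomp_dag_unit_hom)

section \<open>Uniqueness of the functor structure\<close>

lemma relative_monad_fhom:
  assumes monad: "relative_monad V A E j f dag \<eta>" and f: "fobj f = t"
    and [simp]: "x \<in> vobj A" "y \<in> vobj A"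
  shows "fhom f x y = dag x y \<cdot> unit_hom x y"
proof -
  have f_vfun: "vfunctor V A E f"
    using monad by (simp add: relative_monad_def)
  note [simp] = vfunctor_simps[OF f_vfun, unfolded f]
  let ?T = "vhom E (t x) (t y)"
  let ?k = "(\<eta> x \<boxtimes> fhom f x y) \<cdot> inv_arr V (lunit V (vhom A x y))"
  have unit: "unit_hom x y = vpre V E (fobj j x) (t x) (t y) (\<eta> x) \<cdot> fhom f x y"
    using monad by (simp add: relative_monad_def vnatural_def unit_hom_def f)
  \<comment> \<open>Naturality (b) at the objects \<open>x\<close>, \<open>x\<close>,
    \<open>y\<close>. Inserting \<open>\<eta> x\<close> into the first factor turns its left side
    into \<open>dag x y\<close> after \<open>unit_hom x y\<close>, by \<open>unit\<close>.\<close>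
  have dag: "dag x y \<cdot> vcomp E (fobj j x) (t x) (t y) \<cdot>
        (Ident V (vhom E (fobj j x) (t x)) \<boxtimes> fhom f x y)
      = vcomp E (t x) (t x) (t y) \<cdot> (dag x x \<boxtimes> fhom f x y)"
    using monad by (simp add: relative_monad_def f)
  have "dag x y \<cdot> unit_hom x y
      = (dag x y \<cdot> vcomp E (fobj j x) (t x) (t y) \<cdot>
          (Ident V (vhom E (fobj j x) (t x)) \<boxtimes> fhom f x y)) \<cdot>
          (\<eta> x \<boxtimes> Ident V (vhom A x y)) \<cdot> inv_arr V (lunit V (vhom A x y))"
    by (simp add: unit vpre_def A.inv_lunit_natural A.interchange_comp)
  \<comment> \<open>On the other side of (b), \<open>dag x x\<close> now meets
    \<open>\<eta> x\<close>, and (ii) leaves composition with an identity.\<close>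
  also have "\<dots> = vcomp E (t x) (t x) (t y) \<cdot> (vid E (t x) \<boxtimes> fhom f x y) \<cdot>
      inv_arr V (lunit V (vhom A x y))"
    unfolding dag by (simp add: A.interchange_comp dag_eta)
  also have "\<dots> = vpre V E (t x) (t x) (t y) (vid E (t x)) \<cdot> fhom f x y"
    by (simp add: vpre_def A.inv_lunit_natural A.interchange_comp)
  also have "\<dots> = fhom f x y"
    by (simp add: E.vpre_vid)
  finally show ?thesis ..
qed

lemma relative_monad_unique:
  assumes monad: "relative_monad V A E j f dag \<eta>" and f: "fobj f = t"
  shows "f = extension_vfun"
proof -
  have "vfunctor V A E f"
    using monad by (simp add: relative_monad_def)
  then have 1: "fhom f \<in> (\<Pi>\<^sub>E x\<in>vobj A. \<Pi>\<^sub>E y\<in>vobj A. hom V (vhom A x y) (vhom E (t x) (t y)))"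
    by (simp add: vfunctor_def f)
  have 2: "fhom extension_vfun
      \<in> (\<Pi>\<^sub>E x\<in>vobj A. \<Pi>\<^sub>E y\<in>vobj A. hom V (vhom A x y) (vhom E (t x) (t y)))"
    using vfunctor_extension_vfun by (simp add: vfunctor_def)
  \<comment> \<open>Both families are extensional in each argument, so agreement on pairs of objects
    of \<open>A\<close> makes them equal as functions.\<close>
  have "fhom f = fhom extension_vfun"
  proof (rule PiE_ext[OF 1 2])
    fix x assume x: "x \<in> vobj A"
    show "fhom f x = fhom extension_vfun x"
      by (rule PiE_ext[OF PiE_mem[OF 1 x] PiE_mem[OF 2 x]])
        (simp add: relative_monad_fhom[OF assms] x)
  qed
  then show ?thesis
    using f by simp
qed

end

section \<open>Relative monad morphisms and the equivalence\<close>

lemma relative_monad_extension_data: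
  assumes "vcategory V A" "vcategory V E" "relative_monad V A E j t dag \<eta>"
  shows "extension_data V A E j (fobj t) dag \<eta>"
  using assms
  by (simp add: extension_data_def extension_data_axioms_def relative_monad_def vfunctor_def)

lemma preserves_extension_system_vnatural:
  assumes "vcategory V A" "vcategory V E"
    and monad: "relative_monad V A E j t dag \<eta>" and monad': "relative_monad V A E j t' dag' \<eta>'"
    and tau: "\<tau> \<in> (\<Pi>\<^sub>E x\<in>vobj A. hom V \<I>\<^bsub>V\<^esub> (vhom E (fobj t x) (fobj t' x)))"
    and pres: "preserves_extension_system V A E (fobj j) (fobj t) dag \<eta> (fobj t') dag' \<eta>' \<tau>"
  shows "vnatural V A E t t' \<tau>"
proof -
  interpret T: extension_data V A E j "fobj t" dag \<eta>
    using assms relative_monad_extension_data by blast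
  interpret T': extension_data V A E j "fobj t'" dag' \<eta>'
    using assms relative_monad_extension_data by blast
  have [simp]: "\<tau> x \<in> Arr V" "Dom V (\<tau> x) = \<I>\<^bsub>V\<^esub>" "Cod V (\<tau> x) = vhom E (fobj t x) (fobj t' x)"
    if "x \<in> vobj A" for x
    using tau that unfolding PiE_iff hom_def by auto
  have "vpost V E (fobj t x) (fobj t y) (fobj t' y) (\<tau> y) \<cdot>\<^bsub>V\<^esub> fhom t x y
      = vpre V E (fobj t x) (fobj t' x) (fobj t' y) (\<tau> x) \<cdot>\<^bsub>V\<^esub> fhom t' x y"
    if [simp]: "x \<in> vobj A" "y \<in> vobj A" for x y
  proof -
    let ?post = "\<lambda>x. vpost V E x (fobj t y) (fobj t' y) (\<tau> y)"
    let ?pre = "vpre V E (fobj t x) (fobj t' x) (fobj t' y) (\<tau> x)"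
    have "\<eta>' y = ?post (fobj j y) \<cdot>\<^bsub>V\<^esub> \<eta> y"
      using pres by (simp add: preserves_extension_system_def)
    \<comment> \<open>The first morphism equation at \<open>y\<close> makes \<open>\<eta>' y\<close>
      a postcomposite of \<open>\<eta> y\<close>, and \<open>vpost_vpost\<close> splits it off. The
      same postcomposition with \<open>\<tau> y\<close> is the last factor of the second morphism
      equation, so the two equations fit together.\<close>
    then have unit: "T'.unit_hom x y = ?post (fobj j x) \<cdot>\<^bsub>V\<^esub> T.unit_hom x y"
      by (simp add: T.unit_hom_def T'.unit_hom_def T.E.vpost_vpost)
    have dag: "?post (fobj t x) \<cdot>\<^bsub>V\<^esub> dag x y = ?pre \<cdot>\<^bsub>V\<^esub> dag' x y \<cdot>\<^bsub>V\<^esub> ?post (fobj j x)"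
      using pres by (simp add: preserves_extension_system_def)
    have "?post (fobj t x) \<cdot>\<^bsub>V\<^esub> fhom t x y
        = (?post (fobj t x) \<cdot>\<^bsub>V\<^esub> dag x y) \<cdot>\<^bsub>V\<^esub> T.unit_hom x y"
      by (simp add: T.relative_monad_fhom[OF monad])
    also have "\<dots> = ?pre \<cdot>\<^bsub>V\<^esub> dag' x y \<cdot>\<^bsub>V\<^esub> T'.unit_hom x y"
      unfolding dag by (simp add: unit)
    finally show ?thesis
      by (simp add: T'.relative_monad_fhom[OF monad'])
  qed
  then show ?thesis
    using tau by (simp add: vnatural_def)
qed

theorem theorem8p12:
  fixes V :: "('o, 'm) moncat"
    and A :: "('a, 'o, 'm) vcat"
    and E :: "('e, 'o, 'm) vcat"
  assumes "monoidal_category V"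
    and "vcategory V A"
    and "vcategory V E"
  shows "(\<forall>j t\<^sub>0 dag \<eta>.
            vfunctor V A E j \<and> t\<^sub>0 \<in> vobj A \<rightarrow>\<^sub>E vobj E \<and>
            extension_system V A E (fobj j) t\<^sub>0 dag \<eta> \<longrightarrow>
            (\<exists>!t. fobj t = t\<^sub>0 \<and> relative_monad V A E j t dag \<eta>))
       \<and> (\<forall>j t dag \<eta>.
            relative_monad V A E j t dag \<eta> \<longrightarrow>
            vfunctor V A E j \<and> fobj t \<in> vobj A \<rightarrow>\<^sub>E vobj E \<and>
            extension_system V A E (fobj j) (fobj t) dag \<eta>)
       \<and> (\<forall>j t dag \<eta> t' dag' \<eta>'.
            relative_monad V A E j t dag \<eta> \<and> relative_monad V A E j t' dag' \<eta>' \<longrightarrow>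
            (\<forall>\<tau>. relative_monad_morphism V A E j t dag \<eta> t' dag' \<eta>' \<tau> \<longleftrightarrow>
               \<tau> \<in> (\<Pi>\<^sub>E x\<in>vobj A. hom V \<I>\<^bsub>V\<^esub> (vhom E (fobj t x) (fobj t' x))) \<and>
               preserves_extension_system V A E (fobj j) (fobj t) dag \<eta> (fobj t') dag' \<eta>' \<tau>))"
proof (intro conjI)
  show "\<forall>j t\<^sub>0 dag \<eta>.
      vfunctor V A E j \<and> t\<^sub>0 \<in> vobj A \<rightarrow>\<^sub>E vobj E \<and> extension_system V A E (fobj j) t\<^sub>0 dag \<eta> \<longrightarrow>
      (\<exists>!t. fobj t = t\<^sub>0 \<and> relative_monad V A E j t dag \<eta>)"
  proof (intro allI impI)
    fix j :: "('a, 'e, 'm) vfun" and t\<^sub>0 :: "'a \<Rightarrow> 'e" and dag \<eta>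
    assume "vfunctor V A E j \<and> t\<^sub>0 \<in> vobj A \<rightarrow>\<^sub>E vobj E \<and>
      extension_system V A E (fobj j) t\<^sub>0 dag \<eta>"
    then interpret extension_data V A E j t\<^sub>0 dag \<eta>
      using assms by (simp add: extension_data_def extension_data_axioms_def)
    show "\<exists>!t. fobj t = t\<^sub>0 \<and> relative_monad V A E j t dag \<eta>"
      using relative_monad_unique
      by (intro ex1I[of _ extension_vfun]) (simp_all add: relative_monad_extension_vfun)
  qed
  show "\<forall>j t dag \<eta>. relative_monad V A E j t dag \<eta> \<longrightarrow>
      vfunctor V A E j \<and> fobj t \<in> vobj A \<rightarrow>\<^sub>E vobj E \<and>
      extension_system V A E (fobj j) (fobj t) dag \<eta>"
    by (simp add: relative_monad_def vfunctor_def)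
  show "\<forall>j t dag \<eta> t' dag' \<eta>'.
      relative_monad V A E j t dag \<eta> \<and> relative_monad V A E j t' dag' \<eta>' \<longrightarrow>
      (\<forall>\<tau>. relative_monad_morphism V A E j t dag \<eta> t' dag' \<eta>' \<tau> \<longleftrightarrow>
         \<tau> \<in> (\<Pi>\<^sub>E x\<in>vobj A. hom V \<I>\<^bsub>V\<^esub> (vhom E (fobj t x) (fobj t' x))) \<and>
         preserves_extension_system V A E (fobj j) (fobj t) dag \<eta> (fobj t') dag' \<eta>' \<tau>)"
    \<comment> \<open>Naturality of \<open>\<tau>\<close> is the only condition to be derived; the
      remaining conditions match by definition.\<close>
    using preserves_extension_system_vnatural[OF assms(2,3)]
    unfolding relative_monad_morphism_def vnatural_def by blast
qed

end
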